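(* Let $d=n-1$, and let $P:\mathbb{R}^n\to\mathbb{R}^n$ be a homogeneous harmonic polynomial mapping of degree $m$. Near the north pole $N=e_n$ of $S^{n-1}$ use the local coordinates $$\theta(u)=\bigl(u,\sqrt{1-|u|^2}\bigr),\qquad u\in\mathbb{R}^d,\ |u|<1,$$ and put $F(u)=P(\theta(u))$. Suppose that, after an orientation-preserving linear change in the target (that is, after replacing $P$ by $L\circ P$ for a linear map $L$ of positive determinant), $$F(0)=e_n,\qquad \partial_\alpha F(0)=e_\alpha,\quad \alpha=1,\ldots,d.$$ Put $j(u)=J_P(\theta(u))$, $H^i_{\alpha\beta}=\partial_{\alpha\beta}F^i(0)$, and $$T_\gamma=\sum_{p=1}^{d}H^p_{p\gamma},\qquad Q(H)=\sum_{\gamma=1}^{d}\sum_{p,q=1}^{d}H^p_{q\gamma}H^q_{p\gamma},\qquad \mu=(m-1)(m+d).$$ Then $$\partial_\gamma j(0)=mT_\gamma,\qquad \gamma=1,\dots,d,$$ and $$\Delta j(0)=m\left(\sum_{\gamma=1}^{d}T_\gamma^2-Q(H)-(d-1)\mu\right).$$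
   Context: $J_P=\det DP$ is the Jacobian of $P:\mathbb{R}^n\to\mathbb{R}^n$; $e_1,\dots,e_n$ is the standard basis; $F^i$ is the $i$-th component of $F$; $\partial_\alpha=\partial/\partial u_\alpha$; $\Delta=\sum_{\gamma=1}^d\partial_{\gamma\gamma}$ is the Euclidean Laplacian in the coordinates $u\in\mathbb{R}^d$. A homogeneous harmonic mapping of degree $m$ is one whose components are homogeneous harmonic polynomials of degree $m$ (Euclidean Laplacian). All quantities are computed for the normalized map. *)

theory Defs
  imports "HOL-Analysis.Analysis"
begin

text \<open>
  With \<open>d = CARD('d)\<close>, the space \<open>\<real>\<^sup>d\<close> is \<open>real ^ 'd\<close> and \<open>\<real>\<^sup>n\<close>, \<open>n = d + 1\<close>, is
  \<open>real ^ 'd option\<close>: the index \<open>Some \<alpha>\<close> stands for the \<open>\<alpha>\<close>-th coordinate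
  (\<open>\<alpha> = 1, \<dots>, d\<close>) and \<open>None\<close> for the \<open>n\<close>-th one.
\<close>

definition partial :: "'k::finite \<Rightarrow> (real ^ 'k \<Rightarrow> 'b::real_normed_vector) \<Rightarrow> real ^ 'k \<Rightarrow> 'b"
  where "partial \<alpha> f u = vector_derivative (\<lambda>t. f (u + t *\<^sub>R axis \<alpha> 1)) (at 0)"

definition laplacian :: "(real ^ 'k::finite \<Rightarrow> 'b::real_normed_vector) \<Rightarrow> real ^ 'k \<Rightarrow> 'b"
  where "laplacian f u = (\<Sum>\<gamma>\<in>UNIV. partial \<gamma> (partial \<gamma> f) u)"

text \<open>The zero polynomial counts as homogeneous of every degree.\<close>

definition homogeneous_polynomial :: "nat \<Rightarrow> (real ^ 'k::finite \<Rightarrow> real) \<Rightarrow> bool"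
  where "homogeneous_polynomial m p \<longleftrightarrow>
    real_polynomial_function p \<and> (\<forall>t x. p (t *\<^sub>R x) = t ^ m * p x)"

definition homogeneous_harmonic_map ::
    "nat \<Rightarrow> (real ^ 'k::finite \<Rightarrow> real ^ 'l::finite) \<Rightarrow> bool"
  where "homogeneous_harmonic_map m P \<longleftrightarrow>
    (\<forall>i. homogeneous_polynomial m (\<lambda>x. P x $ i) \<and> (\<forall>x. laplacian (\<lambda>x. P x $ i) x = 0))"

definition jacobian_det :: "(real ^ 'k::finite \<Rightarrow> real ^ 'k) \<Rightarrow> real ^ 'k \<Rightarrow> real"
  where "jacobian_det P x = det (matrix (frechet_derivative P (at x)))"

text \<open>Meaningful for \<open>norm u < 1\<close>; all derivatives of it are taken at or near \<open>u = 0\<close>.\<close>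

definition north_chart :: "real ^ 'd::finite \<Rightarrow> real ^ 'd option"
  where "north_chart u = (\<chi> i. case i of Some \<alpha> \<Rightarrow> u $ \<alpha> | None \<Rightarrow> sqrt (1 - (norm u)\<^sup>2))"

end

theory Submission
  imports Defs
begin

text \<open>
  The Jacobian \<open>J\<close> of \<open>P\<close> is a polynomial on \<open>\<real>\<^sup>n\<close>. Since \<open>\<partial>\<^sub>\<alpha>\<^sub>\<beta> sqrt (1 - |u|\<^sup>2)\<close> is
  \<open>-\<delta>\<^sub>\<alpha>\<^sub>\<beta>\<close> at \<open>u = 0\<close>, one has \<open>\<Delta>j(0) = \<Sum>\<gamma>. \<partial>\<^sub>\<gamma>\<^sub>\<gamma>J(N) - d \<partial>\<^sub>nJ(N)\<close>. By the normalization and Euler's identity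
  \<open>DP(N) = diag(1, \<dots>, 1, m)\<close>, and at a diagonal matrix only the identity and the transpositions
  contribute to the first two derivatives of a determinant. Euler's identity for the partial
  derivatives of \<open>P\<close> evaluates every derivative in the direction \<open>N\<close>, and harmonicity turns the
  sums \<open>\<Sum>\<gamma>. \<partial>\<^sub>\<gamma>\<^sub>\<gamma>\<close> into \<open>-\<partial>\<^sub>n\<^sub>n\<close>; what is left in terms of \<open>H\<close> is \<open>\<Sum>\<gamma>. T\<^sub>\<gamma>\<^sup>2 - Q(H)\<close>.
\<close>



section \<open>Partial derivatives and the Frechet derivative\<close>

lemma partial_eq_derivative:
  assumes "(f has_derivative f') (at u)"
  shows "partial k f u = f' (axis k 1)"
proof -
  have "((\<lambda>t. u + t *\<^sub>R axis k (1::real)) has_derivative (\<lambda>t. t *\<^sub>R axis k 1)) (at 0)"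
    by (auto intro!: derivative_eq_intros)
  moreover have "(f has_derivative f') (at (u + 0 *\<^sub>R axis k 1))"
    using assms by simp
  ultimately have "((\<lambda>t. f (u + t *\<^sub>R axis k 1)) has_derivative (\<lambda>t. f' (t *\<^sub>R axis k 1))) (at 0)"
    by (rule has_derivative_compose)
  moreover have "f' (t *\<^sub>R axis k 1) = t *\<^sub>R f' (axis k 1)" for t
    using has_derivative_linear[OF assms] by (rule linear_scale)
  ultimately show ?thesis
    unfolding partial_def by (intro vector_derivative_at) (simp add: has_vector_derivative_def)
qed

text \<open>Partial derivatives are local. This is needed because the formula for the first
  derivatives in the chart holds only for \<open>norm u < 1\<close>, yet it has to be differentiated
  again.\<close>

lemma partial_transform_open:
  assumes "open S" "u \<in> S" "\<And>v. v \<in> S \<Longrightarrow> f v = g v"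
    and "(g has_derivative g') (at u)"
  shows "partial k f u = partial k g u"
proof -
  have "(f has_derivative g') (at u)"
    using has_derivative_transform_within_open[OF assms(4,1,2)] assms(3) by auto
  then show ?thesis
    using assms(4) by (simp add: partial_eq_derivative)
qed

lemma partial_nth:
  assumes "(f has_derivative f') (at u)"
  shows "partial k f u $ i = partial k (\<lambda>v. f v $ i) u"
proof -
  have "((\<lambda>v. f v $ i) has_derivative (\<lambda>h. f' h $ i)) (at u)"
    by (rule bounded_linear.has_derivative[OF bounded_linear_vec_nth assms])
  with assms show ?thesis
    by (simp add: partial_eq_derivative)
qed

lemma has_derivative_vec_components:
  fixes f :: "'a::real_normed_vector \<Rightarrow> real ^ 'n::finite"
  assumes "\<And>i. ((\<lambda>x. f x $ i) has_derivative (\<lambda>h. f' h $ i)) (at x)"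
  shows "(f has_derivative f') (at x)"
  unfolding has_derivative_componentwise_within[of f]
  using assms by (auto simp: Basis_vec_def inner_axis)


subsection \<open>Partial derivatives of polynomial functions\<close>

lemma sum_axis_nth_mult: "(\<Sum>l\<in>UNIV. axis k 1 $ l * g l) = g k"
  for g :: "'k::finite \<Rightarrow> 'b::semiring_1"
proof -
  have "(\<Sum>l\<in>UNIV. axis k 1 $ l * g l) = (\<Sum>l\<in>UNIV. if l = k then g l else 0)"
    by (intro sum.cong) (auto simp: axis_def)
  then show ?thesis by simp
qed

text \<open>Induction over the construction of \<open>p\<close>. The gradient is an unspecified
  family \<open>g\<close>, so that polynomiality and the derivative formula pass through the
  induction together; \<open>g k\<close> is identified with \<open>partial k p\<close> only
  afterwards.\<close>

lemma real_polynomial_function_has_derivative_exists: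
  fixes p :: "real ^ 'k::finite \<Rightarrow> real"
  assumes "real_polynomial_function p"
  shows "\<exists>g. (\<forall>k. real_polynomial_function (g k)) \<and>
    (\<forall>x. (p has_derivative (\<lambda>h. \<Sum>k\<in>UNIV. h $ k * g k x)) (at x))"
  using assms
proof induction
  case (linear f)
  have "f h = (\<Sum>k\<in>UNIV. h $ k * f (axis k 1))" for h
  proof -
    have "f (\<Sum>k\<in>UNIV. h $ k *\<^sub>R axis k 1) = (\<Sum>k\<in>UNIV. h $ k * f (axis k 1))"
      using linear by (simp add: linear_sum linear_scale bounded_linear.linear)
    then show ?thesis
      using basis_expansion[of h] by (simp add: scalar_mult_eq_scaleR)
  qed
  then have "(\<lambda>h. \<Sum>k\<in>UNIV. h $ k * f (axis k 1)) = f"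
    by (intro ext) (rule sym)
  then show ?case
    by (intro exI[of _ "\<lambda>k x. f (axis k 1)"])
      (simp add: bounded_linear_imp_has_derivative linear real_polynomial_function.intros(2))
next
  case (const c)
  show ?case
    by (intro exI[of _ "\<lambda>k x. 0"]) (simp add: real_polynomial_function.intros(2))
next
  case (add p q)
  from add.IH(1) obtain g where g: "\<And>k. real_polynomial_function (g k)"
    and dp: "\<And>x. (p has_derivative (\<lambda>v. \<Sum>k\<in>UNIV. v $ k * g k x)) (at x)" by blast
  from add.IH(2) obtain h where h: "\<And>k. real_polynomial_function (h k)"
    and dq: "\<And>x. (q has_derivative (\<lambda>v. \<Sum>k\<in>UNIV. v $ k * h k x)) (at x)" by blast
  have "((\<lambda>x. p x + q x) has_derivative (\<lambda>v. \<Sum>k\<in>UNIV. v $ k * (g k x + h k x))) (at x)" for x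
    using has_derivative_add[OF dp dq, of x] by (simp add: distrib_left sum.distrib)
  with g h show ?case
    by (intro exI[of _ "\<lambda>k x. g k x + h k x"]) (simp add: real_polynomial_function.intros(3))
next
  case (mult p q)
  from mult.IH(1) obtain g where g: "\<And>k. real_polynomial_function (g k)"
    and dp: "\<And>x. (p has_derivative (\<lambda>v. \<Sum>k\<in>UNIV. v $ k * g k x)) (at x)" by blast
  from mult.IH(2) obtain h where h: "\<And>k. real_polynomial_function (h k)"
    and dq: "\<And>x. (q has_derivative (\<lambda>v. \<Sum>k\<in>UNIV. v $ k * h k x)) (at x)" by blast
  have "((\<lambda>x. p x * q x) has_derivative
      (\<lambda>v. \<Sum>k\<in>UNIV. v $ k * (p x * h k x + g k x * q x))) (at x)" for x
    using has_derivative_mult[OF dp dq, of x]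
    by (simp add: distrib_left sum.distrib sum_distrib_left sum_distrib_right mult_ac)
  with g h mult.hyps show ?case
    by (intro exI[of _ "\<lambda>k x. p x * h k x + g k x * q x"])
      (simp add: real_polynomial_function.intros(3,4))
qed

lemma
  fixes p :: "real ^ 'k::finite \<Rightarrow> real"
  assumes "real_polynomial_function p"
  shows real_polynomial_function_has_derivative:
      "(p has_derivative (\<lambda>h. \<Sum>k\<in>UNIV. h $ k * partial k p x)) (at x)"
    and real_polynomial_function_partial: "real_polynomial_function (partial k p)"
proof -
  obtain g where g: "\<And>k. real_polynomial_function (g k)"
    and d: "\<And>x. (p has_derivative (\<lambda>h. \<Sum>k\<in>UNIV. h $ k * g k x)) (at x)"
    using real_polynomial_function_has_derivative_exists[OF assms] by blast
  have "partial k p = g k" for k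
  proof
    fix x
    show "partial k p x = g k x"
      using partial_eq_derivative[OF d] by (simp add: sum_axis_nth_mult)
  qed
  with g d show "(p has_derivative (\<lambda>h. \<Sum>k\<in>UNIV. h $ k * partial k p x)) (at x)"
    "real_polynomial_function (partial k p)" by auto
qed

lemma partial_const: "partial k (\<lambda>x. c) = (\<lambda>x. 0)"
  by (intro ext partial_eq_derivative has_derivative_const)

lemma partial_bounded_linear:
  assumes "bounded_linear f"
  shows "partial k f = (\<lambda>x. f (axis k 1))"
  by (intro ext partial_eq_derivative bounded_linear_imp_has_derivative assms)

lemma partial_nth_coordinate: "partial k (\<lambda>x. x $ l) = (\<lambda>x. if l = k then 1 else 0)"
  using partial_bounded_linear[OF bounded_linear_vec_nth[of l]] by (auto simp: axis_def)

context
  fixes p q :: "real ^ 'k::finite \<Rightarrow> real"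
  assumes p: "real_polynomial_function p" and q: "real_polynomial_function q"
begin

lemma partial_add: "partial k (\<lambda>x. p x + q x) = (\<lambda>x. partial k p x + partial k q x)"
proof
  fix x
  note d = p[THEN real_polynomial_function_has_derivative, of x]
    q[THEN real_polynomial_function_has_derivative, of x]
  show "partial k (\<lambda>x. p x + q x) x = partial k p x + partial k q x"
    using partial_eq_derivative[OF has_derivative_add[OF d], of k]
    by (simp add: sum_axis_nth_mult)
qed

lemma partial_mult: "partial k (\<lambda>x. p x * q x) = (\<lambda>x. p x * partial k q x + partial k p x * q x)"
proof
  fix x
  note d = p[THEN real_polynomial_function_has_derivative, of x]
    q[THEN real_polynomial_function_has_derivative, of x]
  show "partial k (\<lambda>x. p x * q x) x = p x * partial k q x + partial k p x * q x"
    using partial_eq_derivative[OF has_derivative_mult[OF d], of k]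
    by (simp add: sum_axis_nth_mult)
qed

end

lemma partial_cmult:
  assumes "real_polynomial_function p"
  shows "partial k (\<lambda>x. c * p x) = (\<lambda>x. c * partial k p x)"
  using partial_mult[OF real_polynomial_function.intros(2) assms] by (simp add: partial_const)

lemma partial_sum:
  assumes "finite I" "\<And>i. i \<in> I \<Longrightarrow> real_polynomial_function (f i)"
  shows "partial k (\<lambda>x. \<Sum>i\<in>I. f i x) = (\<lambda>x. \<Sum>i\<in>I. partial k (f i) x)"
  using assms
proof (induction rule: finite_induct)
  case empty
  show ?case by (simp add: partial_const)
next
  case (insert i I)
  then have "partial k (\<lambda>x. f i x + (\<Sum>i\<in>I. f i x))
      = (\<lambda>x. partial k (f i) x + partial k (\<lambda>x. \<Sum>i\<in>I. f i x) x)"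
    by (intro partial_add) auto
  with insert show ?case by simp
qed

lemma partial_prod:
  assumes "finite I" "\<And>i. i \<in> I \<Longrightarrow> real_polynomial_function (f i)"
  shows "partial k (\<lambda>x. \<Prod>i\<in>I. f i x)
    = (\<lambda>x. \<Sum>i\<in>I. partial k (f i) x * (\<Prod>j\<in>I - {i}. f j x))"
proof
  fix x
  have d: "(f i has_derivative (\<lambda>h. \<Sum>k\<in>UNIV. h $ k * partial k (f i) x)) (at x)" if "i \<in> I" for i
    using real_polynomial_function_has_derivative assms that by blast
  have "partial k (\<lambda>x. \<Prod>i\<in>I. f i x) x
    = (\<Sum>i\<in>I. (\<Sum>l\<in>UNIV. axis k 1 $ l * partial l (f i) x) * (\<Prod>j\<in>I - {i}. f j x))"
    by (rule partial_eq_derivative) (intro has_derivative_prod d)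
  then show "partial k (\<lambda>x. \<Prod>i\<in>I. f i x) x
    = (\<Sum>i\<in>I. partial k (f i) x * (\<Prod>j\<in>I - {i}. f j x))"
    by (simp only: sum_axis_nth_mult)
qed

text \<open>For polynomials the symmetry of second derivatives is algebraic: it is trivial for
  linear and constant functions and survives sums and products.\<close>

lemma partial_commute:
  assumes "real_polynomial_function p"
  shows "partial a (partial b p) = partial b (partial a p)"
  using assms
proof induction
  case (linear f)
  show ?case unfolding partial_bounded_linear[OF linear] partial_const ..
next
  case (const c)
  show ?case unfolding partial_const ..
next
  case (add p q)
  note poly = add.hyps real_polynomial_function_partial[OF add.hyps(1)]
    real_polynomial_function_partial[OF add.hyps(2)]
  show ?case
    using add.IH by (simp only: partial_add poly)
next
  case (mult p q)
  note poly = mult.hyps real_polynomial_function_partial[OF mult.hyps(1)]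
    real_polynomial_function_partial[OF mult.hyps(2)]
  \<comment> \<open>Exchanging \<open>c\<close> and \<open>e\<close> swaps the two middle terms; the
    outer two are symmetric by induction hypothesis.\<close>
  have "partial c (partial e (\<lambda>x. p x * q x)) = (\<lambda>x.
      p x * partial c (partial e q) x + partial c p x * partial e q x
      + (partial e p x * partial c q x + partial c (partial e p) x * q x))" for c e
    by (simp only: partial_mult partial_add real_polynomial_function.intros(4) poly)
  with mult.IH show ?case by (simp add: fun_eq_iff)
qed


subsection \<open>Euler's identity\<close>

text \<open>Both sides are derivatives at \<open>t = 1\<close> of
  \<open>p (t *\<^sub>R x) = t ^ m * p x\<close>, one by the chain rule and one by the power
  rule.\<close>

lemma euler_homogeneous_polynomial:
  assumes "homogeneous_polynomial m p"
  shows "(\<Sum>k\<in>UNIV. x $ k * partial k p x) = real m * p x"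
proof -
  have poly: "real_polynomial_function p" and hom: "p (t *\<^sub>R x) = t ^ m * p x" for t
    using assms by (auto simp: homogeneous_polynomial_def)
  have "(p has_derivative (\<lambda>h. \<Sum>k\<in>UNIV. h $ k * partial k p x)) (at (1 *\<^sub>R x))"
    using real_polynomial_function_has_derivative[OF poly] by simp
  moreover have "((\<lambda>t. t *\<^sub>R x) has_derivative (\<lambda>t. t *\<^sub>R x)) (at 1)"
    by (auto intro!: derivative_eq_intros)
  ultimately have "((\<lambda>t. p (t *\<^sub>R x)) has_derivative
      (\<lambda>t. \<Sum>k\<in>UNIV. (t *\<^sub>R x) $ k * partial k p x)) (at 1)"
    using has_derivative_compose by blast
  then have "((\<lambda>t. t ^ m * p x) has_derivative
      (\<lambda>t. \<Sum>k\<in>UNIV. (t *\<^sub>R x) $ k * partial k p x)) (at 1)"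
    by (simp add: hom)
  moreover have "((\<lambda>t. t ^ m * p x) has_derivative (\<lambda>t. t * (real m * p x))) (at 1)"
    by (auto intro!: derivative_eq_intros)
  ultimately have "(\<lambda>t. \<Sum>k\<in>UNIV. (t *\<^sub>R x) $ k * partial k p x) = (\<lambda>t. t * (real m * p x))"
    by (rule has_derivative_unique)
  from fun_cong[OF this, of 1] show ?thesis by simp
qed

text \<open>A real degree avoids the truncated subtraction in \<open>m - 1\<close>.\<close>

lemma euler_partial:
  assumes "real_polynomial_function p"
    and "\<And>x. (\<Sum>k\<in>UNIV. x $ k * partial k p x) = c * p x"
  shows "(\<Sum>k\<in>UNIV. x $ k * partial k (partial l p) x) = (c - 1) * partial l p x"
proof -
  have nth: "real_polynomial_function (\<lambda>x. x $ k)" for k :: 'a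
    by (intro real_polynomial_function.intros(1) bounded_linear_vec_nth)
  note poly = nth assms(1) real_polynomial_function_partial[OF assms(1)]
  have "partial l (\<lambda>x. \<Sum>k\<in>UNIV. x $ k * partial k p x)
      = (\<lambda>x. \<Sum>k\<in>UNIV. partial l (\<lambda>x. x $ k * partial k p x) x)"
    by (intro partial_sum real_polynomial_function.intros(4) poly finite)
  then have "c * partial l p x = (\<Sum>k\<in>UNIV. partial l (\<lambda>x. x $ k * partial k p x) x)"
    unfolding assms(2) by (simp add: partial_cmult poly fun_eq_iff)
  \<comment> \<open>The derivative of the factor \<open>x $ k\<close> leaves one extra
    \<open>partial l p x\<close>, which is what lowers the degree by one.\<close>
  also have "\<dots> = (\<Sum>k\<in>UNIV. x $ k * partial k (partial l p) x + (if k = l then partial k p x else 0))"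
    by (intro sum.cong refl)
      (auto simp: partial_mult poly partial_nth_coordinate partial_commute[OF assms(1), of l])
  also have "\<dots> = (\<Sum>k\<in>UNIV. x $ k * partial k (partial l p) x) + partial l p x"
    by (simp add: sum.distrib)
  finally show ?thesis by (simp add: algebra_simps)
qed


subsection \<open>The chart\<close>

lemma sum_UNIV_option: "(\<Sum>i\<in>UNIV. f i) = f None + (\<Sum>a\<in>UNIV. f (Some a))"
  for f :: "'d::finite option \<Rightarrow> 'b::comm_monoid_add"
  by (simp add: UNIV_option_conv sum.reindex)

lemma north_chart_0: "north_chart 0 = axis None 1"
  by (auto simp: north_chart_def vec_eq_iff axis_def split: option.split)

text \<open>The bound on \<open>norm u\<close> keeps the radicand positive, where the square root is
  differentiable.\<close>

lemma has_derivative_north_chart: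
  fixes u :: "real ^ 'd::finite"
  assumes "norm u < 1"
  shows "(north_chart has_derivative
    (\<lambda>h. \<chi> i. case i of Some a \<Rightarrow> h $ a | None \<Rightarrow> - (u \<bullet> h) / sqrt (1 - u \<bullet> u))) (at u)"
proof (rule has_derivative_vec_components)
  fix i :: "'d option"
  have pos: "1 - u \<bullet> u > 0"
    using assms by (simp add: abs_square_less_1 flip: power2_norm_eq_inner)
  have "((\<lambda>u. sqrt (1 - u \<bullet> u)) has_derivative (\<lambda>h. - (u \<bullet> h) / sqrt (1 - u \<bullet> u))) (at u)"
    using pos by (auto intro!: derivative_eq_intros simp: inner_commute field_simps)
  moreover have "((\<lambda>u. u $ a) has_derivative (\<lambda>h. h $ a)) (at u)" for a
    by (intro bounded_linear_imp_has_derivative bounded_linear_vec_nth)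
  ultimately show "((\<lambda>u. north_chart u $ i) has_derivative
      (\<lambda>h. (\<chi> i. case i of Some a \<Rightarrow> h $ a | None \<Rightarrow> - (u \<bullet> h) / sqrt (1 - u \<bullet> u)) $ i)) (at u)"
    by (cases i) (auto simp: north_chart_def power2_norm_eq_inner)
qed

context
  fixes f :: "real ^ 'd::finite option \<Rightarrow> real"
  assumes f: "real_polynomial_function f"
begin

lemma has_derivative_polynomial_north_chart:
  assumes "norm u < 1"
  shows "((\<lambda>u. f (north_chart u)) has_derivative
    (\<lambda>h. (\<Sum>a\<in>UNIV. h $ a * partial (Some a) f (north_chart u))
      - (u \<bullet> h) / sqrt (1 - u \<bullet> u) * partial None f (north_chart u))) (at u)"
  using has_derivative_compose[OF has_derivative_north_chart[OF assms]
      real_polynomial_function_has_derivative[OF f]]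
  by (simp add: sum_UNIV_option)

lemma partial_north_chart:
  assumes "norm u < 1"
  shows "partial a (\<lambda>u. f (north_chart u)) u = partial (Some a) f (north_chart u)
    - u $ a / sqrt (1 - u \<bullet> u) * partial None f (north_chart u)"
  using partial_eq_derivative[OF has_derivative_polynomial_north_chart[OF assms], of a]
  by (simp add: sum_axis_nth_mult inner_axis)

lemma partial_north_chart_0:
  "partial a (\<lambda>u. f (north_chart u)) 0 = partial (Some a) f (axis None 1)"
  by (simp add: partial_north_chart north_chart_0)

end

text \<open>In the first-order formula the coefficient of \<open>partial None f\<close> vanishes at
  0 and has derivative \<open>h $ b\<close> there. Hence the product rule leaves only the Kronecker
  delta, which is the curvature of the sphere at the pole.\<close>

lemma partial_partial_north_chart_0:
  fixes f :: "real ^ 'd::finite option \<Rightarrow> real"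
  assumes f: "real_polynomial_function f"
  shows "partial a (partial b (\<lambda>u. f (north_chart u))) 0
    = partial (Some a) (partial (Some b) f) (axis None 1)
      - (if a = b then partial None f (axis None 1) else 0)"
proof -
  let ?g = "\<lambda>u::real^'d. u $ b / sqrt (1 - u \<bullet> u)"
  have "(?g has_derivative (\<lambda>h. h $ b)) (at 0)"
    by (auto intro!: derivative_eq_intros bounded_linear_imp_has_derivative bounded_linear_vec_nth)
  note d = has_derivative_polynomial_north_chart[OF real_polynomial_function_partial[OF f], of 0 "Some b"]
    this
    has_derivative_polynomial_north_chart[OF real_polynomial_function_partial[OF f], of 0 None]
  note D = has_derivative_diff[OF d(1) has_derivative_mult[OF d(2,3)]]
  have "partial a (partial b (\<lambda>u. f (north_chart u))) 0
      = partial a (\<lambda>u. partial (Some b) f (north_chart u) - ?g u * partial None f (north_chart u)) 0"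
    by (rule partial_transform_open[where S = "ball 0 1"])
      (use D partial_north_chart[OF f] in auto)
  also have "\<dots> = partial a (\<lambda>u. partial (Some b) f (north_chart u)) 0
      - (if a = b then partial None f (axis None 1) else 0)"
    using partial_eq_derivative[OF D, of a] partial_eq_derivative[OF d(1), of a]
    by (auto simp: north_chart_0 axis_def)
  also have "partial a (\<lambda>u. partial (Some b) f (north_chart u)) 0
      = partial (Some a) (partial (Some b) f) (axis None 1)"
    by (intro partial_north_chart_0 real_polynomial_function_partial f)
  finally show ?thesis .
qed


subsection \<open>Derivatives of a determinant at a diagonal matrix\<close>

text \<open>Such a permutation acts on \<open>{i, k}\<close> alone. The case \<open>i = k\<close> is
  allowed and says that no permutation moves exactly one point.\<close>

lemma permutes_UNIV_fixing_all_but: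
  assumes "p permutes UNIV" "\<And>l. l \<notin> {i, k} \<Longrightarrow> p l = l"
  shows "p = id \<or> p = Transposition.transpose i k"
proof -
  have p: "p permutes {i, k}"
    using permutes_superset[OF assms(1), of "{i, k}"] assms(2) by auto
  have inj: "p i = p k \<longleftrightarrow> i = k"
    using permutes_inj[OF p] by (rule inj_eq)
  have "p i \<in> {i, k}" "p k \<in> {i, k}"
    using permutes_in_image[OF p] by blast+
  then consider "p i = i" "p k = k" | "p i = k" "p k = i"
    using inj by fastforce
  then show ?thesis
  proof cases
    case 1
    then have "p l = l" for l using assms(2)[of l] by blast
    then show ?thesis by (simp add: fun_eq_iff)
  next
    case 2
    then have "p l = Transposition.transpose i k l" for l
      using assms(2)[of l] by (simp add: Transposition.transpose_def)
    then show ?thesis by (simp add: fun_eq_iff)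
  qed
qed

text \<open>This is the Leibniz expansion of a diagonal matrix whose row \<open>i\<close> is
  replaced by \<open>B\<close>. A permutation other than the identity moves some \<open>l\<close>
  other than \<open>i\<close> and so picks up a zero factor.\<close>

lemma sum_permutations_diagonal_1:
  fixes A :: "'n::finite \<Rightarrow> 'n \<Rightarrow> 'b::comm_ring_1"
  assumes "\<And>i j. i \<noteq> j \<Longrightarrow> A i j = 0"
  shows "(\<Sum>p | p permutes UNIV. of_int (sign p) * (B (p i) * (\<Prod>l\<in>UNIV - {i}. A l (p l))))
    = B i * (\<Prod>l\<in>UNIV - {i}. A l l)"
proof -
  have "(\<Prod>l\<in>UNIV - {i}. A l (p l)) = 0" if p: "p permutes UNIV" "p \<noteq> id" for p
  proof -
    obtain l where "l \<noteq> i" "p l \<noteq> l"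
      using permutes_UNIV_fixing_all_but[OF p(1), of i i] p(2) by auto
    then show ?thesis using assms by (intro prod_zero) (auto intro!: bexI[of _ l])
  qed
  then have "(\<Sum>p | p permutes UNIV. of_int (sign p) * (B (p i) * (\<Prod>l\<in>UNIV - {i}. A l (p l))))
    = (\<Sum>p\<in>{id}. of_int (sign p) * (B (p i) * (\<Prod>l\<in>UNIV - {i}. A l (p l))))"
    by (intro sum.mono_neutral_right) (auto simp: permutes_id finite_permutations)
  then show ?thesis by simp
qed

text \<open>With rows \<open>i\<close> and \<open>k\<close> replaced by \<open>B\<close> and
  \<open>C\<close>, only the identity and the transposition of \<open>i\<close> and \<open>k\<close>
  avoid a zero factor; their signs produce the 2 by 2 minor.\<close>

lemma sum_permutations_diagonal_2:
  fixes A :: "'n::finite \<Rightarrow> 'n \<Rightarrow> 'b::comm_ring_1"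
  assumes "\<And>i j. i \<noteq> j \<Longrightarrow> A i j = 0" and "i \<noteq> k"
  shows "(\<Sum>p | p permutes UNIV. of_int (sign p) *
      (B (p i) * (C (p k) * (\<Prod>l\<in>UNIV - {i} - {k}. A l (p l)))))
    = (B i * C k - B k * C i) * (\<Prod>l\<in>UNIV - {i} - {k}. A l l)"
proof -
  let ?t = "\<lambda>p. of_int (sign p) * (B (p i) * (C (p k) * (\<Prod>l\<in>UNIV - {i} - {k}. A l (p l))))"
  have "(\<Prod>l\<in>UNIV - {i} - {k}. A l (p l)) = 0"
    if p: "p permutes UNIV" "p \<noteq> id" "p \<noteq> Transposition.transpose i k" for p
  proof -
    obtain l where "l \<notin> {i, k}" "p l \<noteq> l"
      using permutes_UNIV_fixing_all_but[OF p(1), of i k] p(2,3) by auto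
    then show ?thesis using assms by (intro prod_zero) (auto intro!: bexI[of _ l])
  qed
  then have "(\<Sum>p | p permutes UNIV. ?t p) = (\<Sum>p\<in>{id, Transposition.transpose i k}. ?t p)"
    by (intro sum.mono_neutral_right)
      (auto simp: permutes_id permutes_swap_id finite_permutations)
  moreover have "id \<noteq> Transposition.transpose i k"
    using assms(2) by (metis id_apply transpose_apply_first)
  moreover have "(\<Prod>l\<in>UNIV - {i} - {k}. A l (Transposition.transpose i k l)) = (\<Prod>l\<in>UNIV - {i} - {k}. A l l)"
    by (intro prod.cong) auto
  ultimately show ?thesis
    using assms(2) by (simp add: sign_swap_id algebra_simps)
qed

context
  fixes a :: "'n::finite \<Rightarrow> 'n \<Rightarrow> real ^ 'k::finite \<Rightarrow> real"
  assumes a: "\<And>i j. real_polynomial_function (a i j)"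
begin

lemma real_polynomial_function_det: "real_polynomial_function (\<lambda>x. det (\<chi> i j. a i j x))"
  unfolding det_def using a
  by (intro real_polynomial_function_sum real_polynomial_function.intros(4)
      real_polynomial_function.intros(2) real_polynomial_function_prod) (auto simp: finite_permutations)

lemma partial_det:
  "partial c (\<lambda>x. det (\<chi> i j. a i j x)) = (\<lambda>x. \<Sum>p | p permutes UNIV. of_int (sign p) *
    (\<Sum>i\<in>UNIV. partial c (a i (p i)) x * (\<Prod>l\<in>UNIV - {i}. a l (p l) x)))"
proof -
  have "partial c (\<lambda>x. det (\<chi> i j. a i j x))
    = (\<lambda>x. \<Sum>p | p permutes UNIV. partial c (\<lambda>x. of_int (sign p) * (\<Prod>i\<in>UNIV. a i (p i) x)) x)"
    unfolding det_def using a
    by (subst partial_sum[symmetric])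
      (auto intro!: real_polynomial_function.intros(4)
        real_polynomial_function_prod real_polynomial_function.intros(2) finite_permutations)
  also have "\<dots> = (\<lambda>x. \<Sum>p | p permutes UNIV. of_int (sign p) *
    (\<Sum>i\<in>UNIV. partial c (a i (p i)) x * (\<Prod>l\<in>UNIV - {i}. a l (p l) x)))"
    by (subst partial_cmult) (auto simp: partial_prod a intro!: real_polynomial_function_prod)
  finally show ?thesis .
qed

text \<open>In each Leibniz summand either one factor is differentiated twice, or two distinct
  factors once each; the latter are indexed by ordered pairs.\<close>

lemma partial_partial_det:
  "partial c (partial c (\<lambda>x. det (\<chi> i j. a i j x))) x = (\<Sum>p | p permutes UNIV. of_int (sign p) *
    (\<Sum>i\<in>UNIV. partial c (partial c (a i (p i))) x * (\<Prod>l\<in>UNIV - {i}. a l (p l) x)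
      + (\<Sum>k\<in>UNIV - {i}. partial c (a i (p i)) x *
          (partial c (a k (p k)) x * (\<Prod>l\<in>UNIV - {i} - {k}. a l (p l) x)))))"
proof -
  note rp = real_polynomial_function.intros(4) real_polynomial_function_prod real_polynomial_function_sum
    real_polynomial_function.intros(2) finite_permutations real_polynomial_function_partial a
  have i: "partial c (\<lambda>x. partial c (a i (p i)) x * (\<Prod>l\<in>UNIV - {i}. a l (p l) x)) x
    = partial c (partial c (a i (p i))) x * (\<Prod>l\<in>UNIV - {i}. a l (p l) x)
      + (\<Sum>k\<in>UNIV - {i}. partial c (a i (p i)) x *
          (partial c (a k (p k)) x * (\<Prod>l\<in>UNIV - {i} - {k}. a l (p l) x)))" for i p
    by (subst partial_mult) (auto simp: partial_prod a sum_distrib_left intro!: rp)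
  have "partial c (partial c (\<lambda>x. det (\<chi> i j. a i j x)))
    = (\<lambda>x. \<Sum>p | p permutes UNIV. partial c (\<lambda>x. of_int (sign p) *
        (\<Sum>i\<in>UNIV. partial c (a i (p i)) x * (\<Prod>l\<in>UNIV - {i}. a l (p l) x))) x)"
    unfolding partial_det by (rule partial_sum) (auto intro!: rp)
  also have "\<dots> = (\<lambda>x. \<Sum>p | p permutes UNIV. of_int (sign p) *
      (\<Sum>i\<in>UNIV. partial c (\<lambda>x. partial c (a i (p i)) x * (\<Prod>l\<in>UNIV - {i}. a l (p l) x)) x))"
    by (subst partial_cmult, (auto intro!: rp)[1], subst partial_sum) (auto intro!: rp)
  finally show ?thesis by (simp add: i)
qed

context
  fixes x :: "real ^ 'k"
  assumes diag: "\<And>i j. i \<noteq> j \<Longrightarrow> a i j x = 0"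
begin

lemma partial_det_diagonal:
  "partial c (\<lambda>x. det (\<chi> i j. a i j x)) x
    = (\<Sum>i\<in>UNIV. partial c (a i i) x * (\<Prod>l\<in>UNIV - {i}. a l l x))"
proof -
  have "partial c (\<lambda>x. det (\<chi> i j. a i j x)) x = (\<Sum>i\<in>UNIV. \<Sum>p | p permutes UNIV.
      of_int (sign p) * (partial c (a i (p i)) x * (\<Prod>l\<in>UNIV - {i}. a l (p l) x)))"
    unfolding partial_det sum_distrib_left by (rule sum.swap)
  then show ?thesis
    by (simp add: sum_permutations_diagonal_1[where A = "\<lambda>i j. a i j x"
          and B = "\<lambda>j. partial c (a _ j) x"] diag)
qed

text \<open>The minors come from the ordered pairs \<open>i \<noteq> k\<close>. For
  \<open>i = k\<close> the bracket is zero, so the double sum may run over all pairs.\<close>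

lemma partial_partial_det_diagonal:
  "partial c (partial c (\<lambda>x. det (\<chi> i j. a i j x))) x
    = (\<Sum>i\<in>UNIV. partial c (partial c (a i i)) x * (\<Prod>l\<in>UNIV - {i}. a l l x))
      + (\<Sum>i\<in>UNIV. \<Sum>k\<in>UNIV. (partial c (a i i) x * partial c (a k k) x
          - partial c (a i k) x * partial c (a k i) x) * (\<Prod>l\<in>UNIV - {i} - {k}. a l l x))"
proof -
  let ?S = "\<lambda>f. \<Sum>p | p permutes (UNIV :: 'n set). of_int (sign p) * f p :: real"
  have "?S (\<lambda>p. partial c (a i (p i)) x *
          (partial c (a k (p k)) x * (\<Prod>l\<in>UNIV - {i} - {k}. a l (p l) x)))
      = (partial c (a i i) x * partial c (a k k) x - partial c (a i k) x * partial c (a k i) x)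
        * (\<Prod>l\<in>UNIV - {i} - {k}. a l l x)" if "i \<noteq> k" for i k
    using that by (intro sum_permutations_diagonal_2[where A = "\<lambda>i j. a i j x"
          and B = "\<lambda>j. partial c (a i j) x" and C = "\<lambda>j. partial c (a k j) x"]) (auto simp: diag)
  then have 2: "(\<Sum>k\<in>UNIV - {i}. ?S (\<lambda>p. partial c (a i (p i)) x *
          (partial c (a k (p k)) x * (\<Prod>l\<in>UNIV - {i} - {k}. a l (p l) x))))
      = (\<Sum>k\<in>UNIV. (partial c (a i i) x * partial c (a k k) x
          - partial c (a i k) x * partial c (a k i) x) * (\<Prod>l\<in>UNIV - {i} - {k}. a l l x))" for i
    by (intro sum.mono_neutral_cong_left) auto
  have 1: "?S (\<lambda>p. partial c (partial c (a i (p i))) x * (\<Prod>l\<in>UNIV - {i}. a l (p l) x))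
      = partial c (partial c (a i i)) x * (\<Prod>l\<in>UNIV - {i}. a l l x)" for i
    by (intro sum_permutations_diagonal_1[where A = "\<lambda>i j. a i j x"
          and B = "\<lambda>j. partial c (partial c (a i j)) x"]) (auto simp: diag)
  have "partial c (partial c (\<lambda>x. det (\<chi> i j. a i j x))) x =
      (\<Sum>i\<in>UNIV. ?S (\<lambda>p. partial c (partial c (a i (p i))) x * (\<Prod>l\<in>UNIV - {i}. a l (p l) x)))
      + (\<Sum>i\<in>UNIV. \<Sum>k\<in>UNIV - {i}. ?S (\<lambda>p. partial c (a i (p i)) x *
          (partial c (a k (p k)) x * (\<Prod>l\<in>UNIV - {i} - {k}. a l (p l) x))))"
    unfolding partial_partial_det sum_distrib_left distrib_left sum.distrib
    by (subst sum.swap, subst (2) sum.swap) (intro arg_cong2[where f = "(+)"] refl sum.cong sum.swap)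
  then show ?thesis by (simp only: 1 2)
qed

end

end


subsection \<open>The Jacobian near the north pole\<close>

text \<open>All conditions are linear in the components, and those of \<open>L \<circ> P\<close> are
  constant linear combinations of those of \<open>P\<close>. Hence one can work with the normalized
  map alone.\<close>

lemma homogeneous_harmonic_map_linear_image:
  fixes P :: "real ^ 'k::finite \<Rightarrow> real ^ 'l::finite" and L :: "real ^ 'l \<Rightarrow> real ^ 'r::finite"
  assumes "homogeneous_harmonic_map m P" "linear L"
  shows "homogeneous_harmonic_map m (L \<circ> P)"
proof -
  have P: "real_polynomial_function (\<lambda>x. P x $ k)" "P (t *\<^sub>R x) $ k = t ^ m * P x $ k"
    "(\<Sum>c\<in>UNIV. partial c (partial c (\<lambda>x. P x $ k)) x) = 0" for k t x
    using assms(1)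
    by (auto simp: homogeneous_harmonic_map_def homogeneous_polynomial_def laplacian_def)
  have L: "L y $ i = (\<Sum>k\<in>UNIV. matrix L $ i $ k * y $ k)" for y i
    by (subst matrix_vector_mul(2)[OF assms(2), symmetric]) (simp add: matrix_vector_mult_def)
  note rp = real_polynomial_function_sum real_polynomial_function.intros(4)
    real_polynomial_function.intros(2) real_polynomial_function_partial P(1)
  show ?thesis
    unfolding homogeneous_harmonic_map_def homogeneous_polynomial_def
  proof (intro allI conjI)
    fix i x
    show "real_polynomial_function (\<lambda>x. (L \<circ> P) x $ i)"
      by (auto simp: L intro!: rp)
    show "(L \<circ> P) (t *\<^sub>R x) $ i = t ^ m * (L \<circ> P) x $ i" for t
      by (simp add: L P(2) sum_distrib_left mult_ac)
    have "partial c (partial c (\<lambda>x. (L \<circ> P) x $ i))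
        = (\<lambda>x. \<Sum>k\<in>UNIV. matrix L $ i $ k * partial c (partial c (\<lambda>x. P x $ k)) x)" for c
      by (simp add: L partial_sum partial_cmult rp)
    then have "laplacian (\<lambda>x. (L \<circ> P) x $ i) x
        = (\<Sum>c\<in>UNIV. \<Sum>k\<in>UNIV. matrix L $ i $ k * partial c (partial c (\<lambda>x. P x $ k)) x)"
      by (simp add: laplacian_def)
    also have "\<dots> = (\<Sum>k\<in>UNIV. matrix L $ i $ k * (\<Sum>c\<in>UNIV. partial c (partial c (\<lambda>x. P x $ k)) x))"
      unfolding sum_distrib_left by (rule sum.swap)
    finally show "laplacian (\<lambda>x. (L \<circ> P) x $ i) x = 0"
      by (simp add: P(3))
  qed
qed

lemma has_derivative_polynomial_map:
  fixes P :: "real ^ 'k::finite \<Rightarrow> real ^ 'l::finite"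
  assumes "\<And>i. real_polynomial_function (\<lambda>x. P x $ i)"
  shows "(P has_derivative (\<lambda>h. \<chi> i. \<Sum>k\<in>UNIV. h $ k * partial k (\<lambda>x. P x $ i) x)) (at x)"
  using real_polynomial_function_has_derivative[OF assms]
  by (intro has_derivative_vec_components) auto

lemma jacobian_det_eq_det_partial:
  fixes P :: "real ^ 'k::finite \<Rightarrow> real ^ 'k"
  assumes "\<And>i. real_polynomial_function (\<lambda>x. P x $ i)"
  shows "jacobian_det P = (\<lambda>x. det (\<chi> i j. partial j (\<lambda>x. P x $ i) x))"
proof
  fix x
  note d = has_derivative_polynomial_map[of P, OF assms, of x]
  have "frechet_derivative P (at x) (axis j 1) $ i = partial j (\<lambda>x. P x $ i) x" for i j
    using partial_nth[OF d, of j i] partial_eq_derivative[OF d, of j]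
    by (simp flip: frechet_derivative_at[OF d])
  then show "jacobian_det P x = det (\<chi> i j. partial j (\<lambda>x. P x $ i) x)"
    by (simp add: jacobian_det_def matrix_def)
qed

text \<open>The Laplacian commutes with \<open>partial l\<close>, so derivatives of harmonic
  polynomials are harmonic.\<close>

lemma sum_partial_partial_partial_eq_0:
  assumes "real_polynomial_function p" "\<And>x. laplacian p x = 0"
  shows "(\<Sum>k\<in>UNIV. partial k (partial k (partial l p)) x) = 0"
proof -
  note rp = real_polynomial_function_partial assms(1)
  have "(\<Sum>k\<in>UNIV. partial k (partial k (partial l p)) x)
      = (\<Sum>k\<in>UNIV. partial l (partial k (partial k p)) x)"
    by (intro sum.cong refl) (metis partial_commute rp)
  also have "\<dots> = partial l (\<lambda>x. \<Sum>k\<in>UNIV. partial k (partial k p) x) x"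
    by (subst partial_sum) (auto intro!: rp)
  also have "\<dots> = 0"
    using assms(2) by (simp add: laplacian_def partial_const)
  finally show ?thesis .
qed

theorem proposition3p1:
  fixes P0 P L :: "real ^ ('d::finite) option \<Rightarrow> real ^ 'd option"
    and m :: nat
    and F :: "real ^ 'd \<Rightarrow> real ^ 'd option"
    and j :: "real ^ 'd \<Rightarrow> real"
    and H :: "'d option \<Rightarrow> 'd \<Rightarrow> 'd \<Rightarrow> real"
    and T :: "'d \<Rightarrow> real"
    and Q \<mu> d :: real
  assumes P0: "homogeneous_harmonic_map m P0"
    and L: "linear L" "det (matrix L) > 0"
    and P: "P = L \<circ> P0"
    and F: "F = (\<lambda>u. P (north_chart u))"
    and F_0: "F 0 = axis None 1"
    and dF_0: "\<And>\<alpha>. partial \<alpha> F 0 = axis (Some \<alpha>) 1"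
    and j: "j = (\<lambda>u. jacobian_det P (north_chart u))"
    and H: "\<And>i \<alpha> \<beta>. H i \<alpha> \<beta> = partial \<alpha> (partial \<beta> (\<lambda>u. F u $ i)) 0"
    and T: "\<And>\<gamma>. T \<gamma> = (\<Sum>p\<in>UNIV. H (Some p) p \<gamma>)"
    and Q: "Q = (\<Sum>\<gamma>\<in>UNIV. \<Sum>p\<in>UNIV. \<Sum>q\<in>UNIV. H (Some p) q \<gamma> * H (Some q) p \<gamma>)"
    and d: "d = real CARD('d)"
    and \<mu>: "\<mu> = (real m - 1) * (real m + d)"
  shows "(\<forall>\<gamma>. partial \<gamma> j 0 = real m * T \<gamma>) \<and>
    laplacian j 0 = real m * ((\<Sum>\<gamma>\<in>UNIV. (T \<gamma>)\<^sup>2) - Q - (d - 1) * \<mu>)"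
proof -

  \<comment> \<open>Polynomial setup and Euler's identities\<close>
  define N :: "real ^ 'd option" where "N = axis None 1"
  define p where "p = (\<lambda>i x. P x $ i)"
  define A where "A = (\<lambda>i j. partial j (p i))"
  define J where "J = (\<lambda>x. det (\<chi> i j. A i j x))"
  have "homogeneous_harmonic_map m P"
    unfolding P using P0 L(1) by (rule homogeneous_harmonic_map_linear_image)
  then have hom: "homogeneous_polynomial m (p i)" and harm: "laplacian (p i) x = 0" for i x
    by (auto simp: homogeneous_harmonic_map_def p_def)
  then have poly_p: "real_polynomial_function (p i)" for i
    by (simp add: homogeneous_polynomial_def)
  then have poly_A: "real_polynomial_function (A i j)" for i j
    unfolding A_def by (rule real_polynomial_function_partial)
  have poly_J: "real_polynomial_function J"
    unfolding J_def by (intro real_polynomial_function_det poly_A)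
  have A_commute: "partial k (A i j) = partial j (A i k)" for i j k
    unfolding A_def by (rule partial_commute[OF poly_p])

  have at_N: "(\<Sum>k\<in>UNIV. N $ k * f k) = f None" for f :: "_ \<Rightarrow> real"
    by (simp add: sum_UNIV_option N_def axis_def)
  have euler0: "(\<Sum>k\<in>UNIV. x $ k * A i k x) = real m * p i x" for i x
    unfolding A_def by (rule euler_homogeneous_polynomial[OF hom])
  then have euler1: "(\<Sum>k\<in>UNIV. x $ k * partial k (A i j) x) = (real m - 1) * A i j x" for i j x
    unfolding A_def by (intro euler_partial[OF poly_p])
  then have euler2: "(\<Sum>k\<in>UNIV. x $ k * partial k (partial l (A i j)) x)
      = (real m - 2) * partial l (A i j) x" for i j l x
    using euler_partial[OF poly_A, of i j "real m - 1"] by simp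

  \<comment> \<open>Values at \<open>N\<close> of the matrix \<open>A\<close> and its
    derivatives\<close>
  have p_N: "p i N = (if i = None then 1 else 0)" for i
    using F_0 by (auto simp: F north_chart_0 p_def N_def axis_def)
  have A_None: "A i None N = (if i = None then real m else 0)" for i
    using euler0[where x = N] by (simp add: at_N p_N)
  have A_Some: "A i (Some a) N = (if i = Some a then 1 else 0)" for i a
  proof -
    \<comment> \<open>The hypothesis \<open>dF_0\<close> concerns the vector-valued
      \<open>F\<close>; passing to components requires that \<open>F\<close> be
      differentiable.\<close>
    have "north_chart differentiable at (0 :: real ^ 'd)"
      unfolding differentiable_def using has_derivative_north_chart[of 0] by auto
    moreover have "P differentiable at (north_chart 0)"
      unfolding differentiable_def
      using has_derivative_polynomial_map[of P, OF poly_p[unfolded p_def]] by blast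
    ultimately have "F differentiable at 0"
      unfolding F using differentiable_chain_at by (force simp: o_def)
    then have "partial a F 0 $ i = partial a (\<lambda>u. F u $ i) 0"
      using partial_nth unfolding differentiable_def by blast
    also have "\<dots> = A i (Some a) N"
      using partial_north_chart_0[OF poly_p] by (simp add: F A_def N_def p_def)
    finally show ?thesis by (simp add: dF_0 axis_def)
  qed
  have diag: "A i j N = 0" if "i \<noteq> j" for i j
    using that by (cases j) (auto simp: A_None A_Some)
  have A_diag: "A l l N = (if l = None then real m else 1)" for l
    by (cases l) (auto simp: A_None A_Some)
  \<comment> \<open>All diagonal entries but the one at \<open>None\<close> are 1, so a product of
    them is \<open>m\<close> or 1 according to whether row \<open>None\<close> is kept.\<close>
  have prod_A: "(\<Prod>l\<in>S. A l l N) = (if None \<in> S then real m else 1)" for S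
    by (simp add: A_diag prod.delta)
  have dA_None: "partial None (A i j) N = (real m - 1) * A i j N" for i j
    using euler1[where x = N] by (simp add: at_N)
  have dA_Some: "partial (Some c) (A i None) N = (real m - 1) * A i (Some c) N" for i c
    by (simp add: A_commute[of _ _ None] dA_None)
  have ddA_None: "partial None (partial None (A i j)) N = (real m - 2) * ((real m - 1) * A i j N)" for i j
    using euler2[where x = N] by (simp add: at_N dA_None)
  \<comment> \<open>The curvature term of the chart is \<open>A (Some i) None N\<close>, which is 0:
    for tangential components \<open>H\<close> is an ordinary second derivative of
    \<open>P\<close>.\<close>
  have H_A: "H (Some i) a b = partial (Some b) (A (Some i) (Some a)) N" for i a b
    using partial_partial_north_chart_0[OF poly_p, of a b "Some i"] A_commute[of "Some a" "Some i" "Some b"]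
      A_None[of "Some i"]
    by (simp add: H F p_def A_def N_def)

  \<comment> \<open>First derivatives of the Jacobian at \<open>N\<close>\<close>
  have dJ: "partial c J N = real m * (\<Sum>a\<in>UNIV. partial c (A (Some a) (Some a)) N)
      + partial c (A None None) N" for c
    unfolding J_def
    by (simp only: partial_det_diagonal[OF poly_A] diag simp_thms)
      (simp add: prod_A sum_UNIV_option sum_distrib_left mult.commute)
  have dJ_Some: "partial (Some c) J N = real m * T c" for c
    by (simp add: dJ dA_Some A_Some T H_A)
  \<comment> \<open>This agrees with Euler's identity for \<open>J\<close>, homogeneous of degree
    \<open>(d + 1) * (m - 1)\<close> with value \<open>m\<close> at \<open>N\<close>.\<close>
  have dJ_None: "partial None J N = real m * (real m - 1) * (d + 1)"
    by (simp add: dJ dA_None A_diag d algebra_simps)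

  \<comment> \<open>Second tangential derivatives of the Jacobian at \<open>N\<close>\<close>
  let ?q = "\<lambda>c. \<Sum>i\<in>UNIV. \<Sum>k\<in>UNIV. H (Some i) k c * H (Some k) i c"
  have ddJ: "partial (Some c) (partial (Some c) J) N =
      real m * (\<Sum>a\<in>UNIV. partial (Some c) (partial (Some c) (A (Some a) (Some a))) N)
      + partial (Some c) (partial (Some c) (A None None)) N
      + real m * ((T c)\<^sup>2 - ?q c)
      - 2 * (real m - 1) * partial (Some c) (A None (Some c)) N" for c
  proof -
    let ?X = "\<lambda>i k. partial (Some c) (A i i) N * partial (Some c) (A k k) N
          - partial (Some c) (A i k) N * partial (Some c) (A k i) N"
    \<comment> \<open>In a mixed minor the diagonal product vanishes, because
      \<open>partial (Some c) (A None None) N\<close> is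
      \<open>(m - 1) * A None (Some c) N = 0\<close>. In the other product the entry
      \<open>A (Some a) None\<close> contributes \<open>m - 1\<close> exactly when
      \<open>a = c\<close>.\<close>
    have cross: "?X None (Some a) = (if a = c then - (real m - 1) * partial (Some c) (A None (Some c)) N else 0)"
      "?X (Some a) None = (if a = c then - (real m - 1) * partial (Some c) (A None (Some c)) N else 0)" for a
      by (auto simp: dA_Some A_Some algebra_simps)
    \<comment> \<open>Tangential pairs keep row \<open>None\<close> and get weight \<open>m\<close>;
      mixed pairs get weight 1.\<close>
    have "(\<Sum>i\<in>UNIV. \<Sum>k\<in>UNIV. ?X i k * (\<Prod>l\<in>UNIV - {i} - {k}. A l l N))
        = real m * (\<Sum>i\<in>UNIV. \<Sum>k\<in>UNIV. ?X (Some i) (Some k))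
          + (\<Sum>a\<in>UNIV. ?X None (Some a)) + (\<Sum>a\<in>UNIV. ?X (Some a) None)"
      by (simp add: sum_UNIV_option prod_A sum.distrib sum_distrib_left mult.commute)
    also have "(\<Sum>i\<in>UNIV. \<Sum>k\<in>UNIV. ?X (Some i) (Some k)) = (T c)\<^sup>2 - ?q c"
      by (simp add: T H_A sum_subtractf power2_eq_square sum_product)
    finally have X: "(\<Sum>i\<in>UNIV. \<Sum>k\<in>UNIV. ?X i k * (\<Prod>l\<in>UNIV - {i} - {k}. A l l N))
        = real m * ((T c)\<^sup>2 - ?q c) - 2 * (real m - 1) * partial (Some c) (A None (Some c)) N"
      unfolding cross by (simp add: left_diff_distrib)
    show ?thesis
      unfolding J_def
      by (simp only: partial_partial_det_diagonal[OF poly_A] diag simp_thms X)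
        (simp add: prod_A sum_UNIV_option sum_distrib_left mult.commute)
  qed

  \<comment> \<open>Consequences of harmonicity at \<open>N\<close>\<close>
  have harm_A: "(\<Sum>c\<in>UNIV. partial (Some c) (partial (Some c) (A i j)) N)
      = - ((real m - 2) * (real m - 1) * A i j N)" for i j
    using sum_partial_partial_partial_eq_0[OF poly_p harm, of j i N] ddA_None[of i j]
    by (simp add: A_def sum_UNIV_option add_eq_0_iff)
  \<comment> \<open>These are the pure second derivatives of the last component; they evaluate the
    mixed minors summed over \<open>c\<close>.\<close>
  have harm_p: "(\<Sum>c\<in>UNIV. partial (Some c) (A None (Some c)) N) = - ((real m - 1) * real m)"
    using harm[of None N] dA_None[of None None] A_None[of None]
    by (simp add: laplacian_def A_def sum_UNIV_option add_eq_0_iff)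
  have sum_ddA: "(\<Sum>c\<in>UNIV. \<Sum>a\<in>UNIV. partial (Some c) (partial (Some c) (A (Some a) (Some a))) N)
      = - (d * (real m - 2) * (real m - 1))"
    by (subst sum.swap) (simp add: harm_A A_diag d)

  \<comment> \<open>Passage to the chart\<close>
  have j_J: "j = (\<lambda>u. J (north_chart u))"
    using jacobian_det_eq_det_partial[of P] poly_p by (simp add: j J_def A_def p_def)
  have "laplacian j 0 = (\<Sum>c\<in>UNIV. partial (Some c) (partial (Some c) J) N - partial None J N)"
    unfolding laplacian_def j_J
    by (intro sum.cong refl) (simp add: partial_partial_north_chart_0[OF poly_J] N_def)
  \<comment> \<open>In order: second derivatives of the tangential diagonal entries, of the corner
    entry, the tangential minors, the mixed minors, and \<open>d\<close> copies of the curvature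
    term.\<close>
  also have "\<dots> = real m * - (d * (real m - 2) * (real m - 1)) - (real m - 2) * (real m - 1) * real m
      + real m * ((\<Sum>c\<in>UNIV. (T c)\<^sup>2) - Q) + 2 * (real m - 1) * ((real m - 1) * real m)
      - d * (real m * (real m - 1) * (d + 1))"
    by (simp add: ddJ sum.distrib sum_subtractf harm_A harm_p sum_ddA dJ_None A_diag Q
        flip: sum_distrib_left d)
  \<comment> \<open>The terms free of \<open>H\<close> are \<open>m * (m - 1)\<close> times
    \<open>2 * (m - 1) - (d + 1) * (m - 2) - d * (d + 1)\<close>, and this last factor equals
    \<open>- (d - 1) * (m + d)\<close>.\<close>
  also have "\<dots> = real m * ((\<Sum>c\<in>UNIV. (T c)\<^sup>2) - Q - (d - 1) * \<mu>)"
    unfolding \<mu> by algebra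
  finally have "laplacian j 0 = real m * ((\<Sum>c\<in>UNIV. (T c)\<^sup>2) - Q - (d - 1) * \<mu>)" .
  moreover have "partial c j 0 = real m * T c" for c
    unfolding j_J partial_north_chart_0[OF poly_J] using dJ_Some by (simp add: N_def)
  ultimately show ?thesis by blast
qed

end
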